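(* Let $(A,\circ,[\cdot,\cdot])$ be a finite-dimensional GD algebra over $\Bbbk$ with $\dim A\le 3$. If the Lie algebra $(A,[\cdot,\cdot])$ and the Novikov algebra $(A,\circ)$ are both nilpotent, then $A$ is nilpotent (as a GD algebra).
   Context: $\Bbbk$ is an algebraically closed field of characteristic $0$. A Novikov algebra is a vector space with a bilinear product $\circ$ satisfying $(x\circ y)\circ z-x\circ(y\circ z)=(y\circ x)\circ z-y\circ(x\circ z)$ and $(x\circ y)\circ z=(x\circ z)\circ y$. A Gelfand--Dorfman (GD) algebra is a triple $(A,\circ,[\cdot,\cdot])$ such that $(A,\circ)$ is a Novikov algebra, $(A,[\cdot,\cdot])$ is a Lie algebra, and for all $x,y,z\in A$: $[x,y\circ z]-[z,y\circ x]+[y,x]\circ z-[y,z]\circ x-y\circ[x,z]=0$. The lower central series of $A$ is $A^{\langle1\rangle}=A$, $A^{\langle n+1\rangle}=\sum_{i=1}^n\bigl(A^{\langle i\rangle}\circ A^{\langle n+1-i\rangle}+[A^{\langle i\rangle},A^{\langle n+1-i\rangle}]\bigr)$ (linear spans); $A$ is nilpotent if $A^{\langle N\rangle}=0$ for some $N\ge1$. The Novikov algebra $(A,\circ)$ is nilpotent if the analogous series using only $\circ$ reaches $0$. *)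

theory Defs
  imports "HOL-Computational_Algebra.Polynomial"
begin

text \<open>All algebras are carried by a whole type of class \<^class>\<open>ab_group_add\<close>, with the
  scalar action of the ground field given by the locale \<^locale>\<open>vector_space\<close>.\<close>

locale bilinear_algebra = vector_space scale
  for scale :: "'k::field \<Rightarrow> 'a::ab_group_add \<Rightarrow> 'a" +
  fixes mult :: "'a \<Rightarrow> 'a \<Rightarrow> 'a"
  assumes linear_left: "Vector_Spaces.linear scale scale (\<lambda>x. mult x y)"
    and linear_right: "Vector_Spaces.linear scale scale (\<lambda>y. mult x y)"

locale novikov_algebra = bilinear_algebra scale circ
  for scale :: "'k::field \<Rightarrow> 'a::ab_group_add \<Rightarrow> 'a" and circ :: "'a \<Rightarrow> 'a \<Rightarrow> 'a" +
  assumes left_symmetric: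
      "circ (circ x y) z - circ x (circ y z) = circ (circ y x) z - circ y (circ x z)"
    and right_commutative: "circ (circ x y) z = circ (circ x z) y"
begin

text \<open>The series starts at index 1; the value at 0 is a dummy. A sum of linear spans is
  written as the span of the union of the generating sets.\<close>

fun lower_series :: "nat \<Rightarrow> 'a set" where
  "lower_series 0 = UNIV"
| "lower_series (Suc 0) = UNIV"
| "lower_series (Suc (Suc n)) =
    span (\<Union>i\<in>{1..Suc n}.
      {circ x y | x y. (x, y) \<in> lower_series i \<times> lower_series (Suc (Suc n) - i)})"

definition nilpotent :: bool where
  "nilpotent \<longleftrightarrow> (\<exists>N\<ge>1. lower_series N = {0})"

end

locale lie_algebra = bilinear_algebra scale br
  for scale :: "'k::field \<Rightarrow> 'a::ab_group_add \<Rightarrow> 'a" and br :: "'a \<Rightarrow> 'a \<Rightarrow> 'a" +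
  assumes alternating: "br x x = 0"
    and jacobi: "br x (br y z) + br y (br z x) + br z (br x y) = 0"
begin

text \<open>The usual lower central series of a Lie algebra, $L^{n+1} = [L, L^n]$,
  again with a dummy value at 0.\<close>

fun lower_series :: "nat \<Rightarrow> 'a set" where
  "lower_series 0 = UNIV"
| "lower_series (Suc 0) = UNIV"
| "lower_series (Suc (Suc n)) = span {br x y | x y. y \<in> lower_series (Suc n)}"

definition nilpotent :: bool where
  "nilpotent \<longleftrightarrow> (\<exists>N\<ge>1. lower_series N = {0})"

end

locale gd_algebra = novikov: novikov_algebra scale circ + lie: lie_algebra scale br
  for scale :: "'k::field \<Rightarrow> 'a::ab_group_add \<Rightarrow> 'a"
    and circ :: "'a \<Rightarrow> 'a \<Rightarrow> 'a" and br :: "'a \<Rightarrow> 'a \<Rightarrow> 'a" +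
  assumes compatible:
    "br x (circ y z) - br z (circ y x) + circ (br y x) z - circ (br y z) x - circ y (br x z) = 0"
begin

fun lower_series :: "nat \<Rightarrow> 'a set" where
  "lower_series 0 = UNIV"
| "lower_series (Suc 0) = UNIV"
| "lower_series (Suc (Suc n)) =
    novikov.span (\<Union>i\<in>{1..Suc n}.
      {circ x y | x y. (x, y) \<in> lower_series i \<times> lower_series (Suc (Suc n) - i)} \<union>
      {br x y | x y. (x, y) \<in> lower_series i \<times> lower_series (Suc (Suc n) - i)})"

definition nilpotent :: bool where
  "nilpotent \<longleftrightarrow> (\<exists>N\<ge>1. lower_series N = {0})"

end

end

theory Submission
  imports Defs
begin

text \<open>If the bracket vanishes, nothing separates the two notions of nilpotency. Otherwise
  choose $x, y$ with $z = [x,y] \neq 0$. In dimension at most three a nilpotent Lie algebra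
  with this property is the Heisenberg algebra: $x, y, z$ is a basis, and $z$ spans both the
  derived algebra and the center. The compatibility identity, evaluated with entries
  chosen to be $z$ or equal to each other, then forces $z \circ z$, $v \circ z$ and
  $z \circ v$ (in this order) to be multiples of $z$. A nilpotent product admits no nonzero
  eigenvalue, so all of them vanish
  (\<open>heisenberg_center_annihilates\<close>), and $z$ spans an ideal $Z$ that
  annihilates $A$ for both products and contains every bracket.

  Modulo such a $Z$ the bracket is zero, hence every term of the GD series lies in the
  corresponding term of the Novikov series plus $Z$. If the Novikov series vanishes at
  step $N$, then from there on the GD series lies in $Z$; at step $2N$ each generating product
  has a factor in $Z$ and is zero (\<open>nilpotent_if_commutators_annihilate\<close>).\<close>

context bilinear_algebra
begin

lemma mult_add_left: "mult (x + y) z = mult x z + mult y z"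
  using linear_left[of z] by (simp add: Vector_Spaces.linear_iff)

lemma mult_add_right: "mult z (x + y) = mult z x + mult z y"
  using linear_right[of z] by (simp add: Vector_Spaces.linear_iff)

lemma mult_scale_left: "mult (scale a x) z = scale a (mult x z)"
  using linear_left[of z] by (simp add: Vector_Spaces.linear_iff)

lemma mult_scale_right: "mult z (scale a x) = scale a (mult z x)"
  using linear_right[of z] by (simp add: Vector_Spaces.linear_iff)

lemma mult_zero_left: "mult 0 z = 0"
  using mult_scale_left[of 0 0 z] by simp

lemma mult_zero_right: "mult z 0 = 0"
  using mult_scale_right[of z 0 0] by simp

lemma mult_minus_left: "mult (- x) z = - mult x z"
  using mult_scale_left[of "-1" x z] by simp

lemma mult_minus_right: "mult z (- x) = - mult z x"
  using mult_scale_right[of z "-1" x] by simp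

lemmas mult_simps = mult_add_left mult_add_right mult_scale_left mult_scale_right
  mult_zero_left mult_zero_right mult_minus_left mult_minus_right

end

section \<open>Nilpotent Lie algebras of dimension at most three\<close>

context lie_algebra
begin

lemma br_skew: "br x y = - br y x"
proof -
  have "br x y + br y x = br (x + y) (x + y)"
    unfolding mult_add_left mult_add_right by (simp add: alternating)
  then show ?thesis
    by (simp only: alternating eq_neg_iff_add_eq_0)
qed

text \<open>A set reproduced by one further bracketing lies in every term of the lower
  central series. This is the only way in which Lie nilpotency enters: eigenvectors and
  two-step cycles of an inner derivation are sets of this kind.\<close>

lemma nilpotent_subset_zero:
  assumes nil: nilpotent and S: "S \<subseteq> span {br u v | u v. v \<in> S}"
  shows "S \<subseteq> {0}"
proof -
  have "S \<subseteq> lower_series n" for n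
  proof (induction n rule: lower_series.induct)
    case (3 n)
    have "span {br u v | u v. v \<in> S} \<subseteq> lower_series (Suc (Suc n))"
      unfolding lower_series.simps using 3 by (intro span_mono) auto
    with S show ?case by blast
  qed auto
  with nil show ?thesis unfolding nilpotent_def by fastforce
qed

lemma nilpotent_eigenvalue_zero:
  assumes nil: nilpotent and u: "u \<noteq> 0" and eig: "br v u = scale c u"
  shows "c = 0"
proof (rule ccontr)
  assume c: "c \<noteq> 0"
  then have "u = scale (inverse c) (br v u)"
    by (simp add: eig)
  also have "\<dots> \<in> span {br w u' | w u'. u' \<in> {u}}"
    by (intro span_scale span_base) auto
  finally have "{u} \<subseteq> {0}"
    by (intro nilpotent_subset_zero nil) auto
  with u show False by simp
qed

text \<open>If $[x,y] = ax + by$, then $[x,y]$ is an eigenvector of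
  $\mathrm{ad}\,x$ with eigenvalue $b$ and of $\mathrm{ad}\,y$ with eigenvalue $-a$.\<close>

lemma nilpotent_commutator_notin_span:
  assumes nil: nilpotent and nz: "br x y \<noteq> 0"
  shows "br x y \<noteq> scale a x + scale b y"
proof
  assume eq: "br x y = scale a x + scale b y"
  have "br x (br x y) = scale b (br x y)"
    by (subst eq) (simp add: mult_simps alternating)
  then have "b = 0"
    using nilpotent_eigenvalue_zero nil nz by blast
  moreover have "br y (br x y) = scale (- a) (br x y)"
    by (subst eq) (simp add: mult_simps alternating br_skew[of y x])
  then have "- a = 0"
    using nilpotent_eigenvalue_zero nil nz by blast
  ultimately show False using eq nz by simp
qed

text \<open>The vectors $x, y, [x,y]$ are linearly independent, so there is no room for
  anything else.\<close>

lemma nilpotent_commutator_spans: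
  assumes fin: "finite_dimensional_vector_space scale B" and dim: "dim (UNIV :: 'a set) \<le> 3"
    and nil: nilpotent and nz: "br x y \<noteq> 0"
  obtains a b c where "v = scale a x + scale b y + scale c (br x y)"
proof -
  interpret fd: finite_dimensional_vector_space scale B by (rule fin)
  let ?z = "br x y"
  have x: "x \<noteq> 0" using nz by (auto simp: mult_zero_left)
  have y: "y \<notin> span {x}"
    using nz by (auto simp: span_breakdown_eq mult_simps alternating)
  have z: "?z \<notin> span {y, x}"
  proof
    assume "?z \<in> span {y, x}"
    then obtain b a where "?z - scale b y - scale a x = 0"
      by (auto simp: span_breakdown_eq)
    then have "?z = scale a x + scale b y" by (simp add: algebra_simps)
    with nilpotent_commutator_notin_span[OF nil nz] show False by blast
  qed
  have ind: "independent {?z, y, x}"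
    using x y z by (auto simp: independent_insert)
  have "card {?z, y, x} = 3"
    using span_base[of y "{x}"] span_base[of ?z "{y, x}"] y z by (auto simp: card_insert_if)
  then have "UNIV \<subseteq> span {?z, y, x}"
    using fd.card_ge_dim_independent[of "{?z, y, x}" UNIV] ind dim by simp
  then have "v \<in> span {?z, y, x}" by blast
  then obtain c b a where "v - scale c ?z - scale b y - scale a x = 0"
    by (auto simp: span_breakdown_eq)
  then show ?thesis
    by (intro that[of a b c]) (simp add: algebra_simps)
qed

text \<open>With $z = [x,y]$, write $w = [x,z]$ as $ax + by + cz$. Then
  $[x,w] = bz + cw$. For $b \neq 0$ this expresses $z$ through $[x,w]$ and $[x,z]$, so
  $\mathrm{ad}\,x$ reproduces the pair $z, w$, contrary to nilpotency. With $b = 0$, a nonzero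
  $w$ is an eigenvector of $\mathrm{ad}\,x$, so $c = 0$; finally $w = ax$ makes $x$ an
  eigenvector of $\mathrm{ad}\,z$, so $a = 0$.\<close>

lemma nilpotent_commutator_central_left:
  assumes fin: "finite_dimensional_vector_space scale B" and dim: "dim (UNIV :: 'a set) \<le> 3"
    and nil: nilpotent and nz: "br x y \<noteq> 0"
  shows "br x (br x y) = 0"
proof (rule ccontr)
  let ?z = "br x y"
  define w where "w = br x ?z"
  assume "br x ?z \<noteq> 0"
  then have w0: "w \<noteq> 0" by (simp add: w_def)
  obtain a b c where w: "w = scale a x + scale b y + scale c ?z"
    using nilpotent_commutator_spans[OF fin dim nil nz] .
  have xw: "br x w = scale b ?z + scale c w"
    by (subst w) (simp add: mult_simps alternating w_def)
  have "b = 0"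
  proof (rule ccontr)
    assume b: "b \<noteq> 0"
    let ?T = "{br u v | u v. v \<in> {?z, w}}"
    have xwT: "br x w \<in> span ?T" and wT: "w \<in> span ?T"
      by (auto intro!: span_base simp: w_def)
    have "scale (inverse b) (br x w - scale c w) \<in> span ?T"
      by (intro span_scale span_diff xwT wT)
    then have "?z \<in> span ?T" using b by (simp add: xw)
    with wT have "{?z, w} \<subseteq> {0}"
      by (intro nilpotent_subset_zero nil) auto
    with w0 show False by simp
  qed
  moreover from this have "c = 0"
    using nilpotent_eigenvalue_zero[OF nil w0, of x c] xw by simp
  ultimately have wx: "w = scale a x" using w by simp
  have "br ?z x = scale (- a) x"
    using wx by (simp add: br_skew[of ?z x] w_def)
  moreover have "x \<noteq> 0" using nz by (auto simp: mult_zero_left)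
  ultimately have "- a = 0"
    using nilpotent_eigenvalue_zero nil by blast
  with wx w0 show False by simp
qed

lemma nilpotent_commutator_central:
  assumes fin: "finite_dimensional_vector_space scale B" and dim: "dim (UNIV :: 'a set) \<le> 3"
    and nil: nilpotent
  shows "br v (br x y) = 0"
proof (cases "br x y = 0")
  case True
  then show ?thesis by (simp add: mult_zero_right)
next
  case nz: False
  have x: "br x (br x y) = 0"
    by (rule nilpotent_commutator_central_left[OF fin dim nil nz])
  have "br y x \<noteq> 0" using nz br_skew[of x y] by simp
  then have "br y (br y x) = 0"
    by (rule nilpotent_commutator_central_left[OF fin dim nil])
  then have y: "br y (br x y) = 0"
    by (simp add: br_skew[of x y] mult_minus_right)
  obtain a b c where "v = scale a x + scale b y + scale c (br x y)"
    using nilpotent_commutator_spans[OF fin dim nil nz] .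
  then show ?thesis by (simp add: mult_simps x y alternating)
qed

text \<open>The bracket is a determinant in the coordinates with respect to $x, y$, times
  $[x,y]$; its radical is therefore the line through $[x,y]$.\<close>

lemma nilpotent_bracket_and_center:
  assumes fin: "finite_dimensional_vector_space scale B" and dim: "dim (UNIV :: 'a set) \<le> 3"
    and nil: nilpotent and nz: "br x y \<noteq> 0"
  shows "\<exists>c. br u v = scale c (br x y)"
    and "(\<And>w. br w u = 0) \<Longrightarrow> \<exists>c. u = scale c (br x y)"
proof -
  define z where "z = br x y"
  have zr: "br w z = 0" for w
    unfolding z_def by (rule nilpotent_commutator_central[OF fin dim nil])
  have zl: "br z w = 0" for w
    using zr[of w] br_skew[of z w] by simp
  have yx: "br y x = - z" using br_skew[of y x] by (simp add: z_def)
  obtain a b c where u: "u = scale a x + scale b y + scale c z"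
    using nilpotent_commutator_spans[OF fin dim nil nz] unfolding z_def .
  obtain a' b' c' where v: "v = scale a' x + scale b' y + scale c' z"
    using nilpotent_commutator_spans[OF fin dim nil nz] unfolding z_def .
  have "br u v = scale (a * b' - b * a') z"
    by (simp add: u v mult_simps zl zr alternating yx z_def[symmetric]
        scale_left_diff_distrib mult.commute)
  then show "\<exists>c. br u v = scale c (br x y)" unfolding z_def by blast
  assume cent: "\<And>w. br w u = 0"
  have "br x u = scale b z" "br y u = scale (- a) z"
    by (simp_all add: u mult_simps zr alternating yx z_def[symmetric])
  with cent nz have "b = 0" "a = 0" by (auto simp: z_def)
  with u show "\<exists>c. u = scale c (br x y)" unfolding z_def by auto
qed

end

section \<open>Nilpotent Novikov algebras\<close>

context novikov_algebra
begin

lemma circ_in_lower_series: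
  assumes "1 \<le> i" "1 \<le> j" "x \<in> lower_series i" "y \<in> lower_series j"
  shows "circ x y \<in> lower_series (i + j)"
proof -
  obtain n where n: "i + j = Suc (Suc n)"
    using assms by (metis Suc_le_D add_Suc_right add_Suc One_nat_def)
  then have "j = Suc (Suc n) - i" "i \<le> Suc n" using assms by auto
  with assms show ?thesis
    unfolding n lower_series.simps by (intro span_base) fastforce
qed

lemma subspace_lower_series: "subspace (lower_series n)"
  by (cases n rule: lower_series.cases) (auto simp: subspace_UNIV subspace_span)

text \<open>Monotonicity needs an argument because the terms are sums over all splittings of
  the index. In a product of terms $i$ and $n+1-i$, one factor can be moved to the
  preceding term of the series: the left one if $i > 1$, the right one if $i = 1$.\<close>

lemma lower_series_Suc_subset: "lower_series (Suc n) \<subseteq> lower_series n"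
proof (induction n rule: less_induct)
  case (less n)
  show ?case
  proof (cases n rule: lower_series.cases)
    case (3 m)
    have "circ x y \<in> lower_series n"
      if i: "1 \<le> i" "i \<le> n" and x: "x \<in> lower_series i" and y: "y \<in> lower_series (Suc n - i)"
      for i x y
    proof (cases "i = 1")
      case True
      have "y \<in> lower_series (n - 1)" using less[of "n - 1"] y True 3 by auto
      then show ?thesis
        using circ_in_lower_series[of 1 "n - 1" x y] 3 by simp
    next
      case False
      with i have "i - 1 < n" "Suc (i - 1) = i" by auto
      with x have "x \<in> lower_series (i - 1)" using less[of "i - 1"] by auto
      moreover have "Suc n - i = n - (i - 1)" using i by auto
      ultimately show ?thesis
        using circ_in_lower_series[of "i - 1" "Suc n - i" x y] y i False by simp
    qed
    then show ?thesis
      unfolding 3 lower_series.simps(3)[of "Suc m"]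
      by (intro span_minimal subspace_lower_series) (auto simp: 3)
  qed auto
qed

text \<open>An eigenvector of a left or right multiplication for a nonzero eigenvalue lies
  in every term of the series.\<close>

lemma nilpotent_circ_eigenvalue_zero:
  assumes nil: nilpotent and u: "u \<noteq> 0"
    and eig: "circ v u = scale c u \<or> circ u v = scale c u"
  shows "c = 0"
proof (rule ccontr)
  assume c: "c \<noteq> 0"
  have mem: "u \<in> lower_series n" for n
  proof (induction n rule: lower_series.induct)
    case (3 n)
    then have u_mem: "u \<in> lower_series (Suc n)" by simp
    have "scale c u \<in> lower_series (Suc (Suc n))"
      using eig circ_in_lower_series[of 1 "Suc n" v u] circ_in_lower_series[of "Suc n" 1 u v] u_mem
      by auto
    then have "scale (inverse c) (scale c u) \<in> lower_series (Suc (Suc n))"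
      by (rule subspace_scale[OF subspace_lower_series])
    with c show ?case by simp
  qed auto
  from nil mem u show False unfolding nilpotent_def by auto
qed

end

section \<open>Passing to the Gelfand--Dorfman algebra\<close>

context gd_algebra
begin

text \<open>The GD series stays inside the Novikov series up to $Z$: when two such sums are
  multiplied, the parts in $Z$ contribute nothing, and brackets land in $Z$. The index $2N$
  guarantees that one of $i$ and $2N-i$ is at least $N$.\<close>

lemma nilpotent_if_commutators_annihilate:
  assumes nil: novikov.nilpotent and Z: "novikov.subspace Z"
    and brZ: "\<And>x y. br x y \<in> Z"
    and ann: "\<And>z v. z \<in> Z \<Longrightarrow> circ z v = 0 \<and> circ v z = 0 \<and> br z v = 0 \<and> br v z = 0"
  shows nilpotent
proof -
  let ?L = "\<lambda>n. {u + z | u z. u \<in> novikov.lower_series n \<and> z \<in> Z}"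
  have sub: "novikov.subspace (?L n)" for n
    by (intro novikov.subspace_sums novikov.subspace_lower_series Z)
  have incl: "lower_series n \<subseteq> ?L n" for n
  proof (induction n rule: less_induct)
    case (less n)
    show ?case
    proof (cases n rule: lower_series.cases)
      case (3 m)
      have "circ x y \<in> ?L n \<and> br x y \<in> ?L n"
        if i: "1 \<le> i" "i \<le> Suc m" and x: "x \<in> lower_series i" and y: "y \<in> lower_series (n - i)"
        for i x y
      proof
        obtain u z where u: "x = u + z" "u \<in> novikov.lower_series i" "z \<in> Z"
          using less[of i] x i 3 by fastforce
        obtain u' z' where u': "y = u' + z'" "u' \<in> novikov.lower_series (n - i)" "z' \<in> Z"
          using less[of "n - i"] y i 3 by fastforce
        have "circ x y = circ u u'"
          by (simp add: u u' novikov.mult_simps ann)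
        moreover have "circ u u' \<in> novikov.lower_series n"
          using novikov.circ_in_lower_series[of i "n - i" u u'] u u' i 3 by auto
        ultimately show "circ x y \<in> ?L n"
          using novikov.subspace_0[OF Z] by force
        show "br x y \<in> ?L n"
          using brZ[of x y] novikov.subspace_0[OF novikov.subspace_lower_series[of n]] by force
      qed
      then show ?thesis
        unfolding 3 lower_series.simps
        by (intro novikov.span_minimal sub[unfolded 3]) (auto simp: 3)
    qed (use novikov.subspace_0[OF Z] in force)+
  qed
  obtain N where N: "N \<ge> 1" "novikov.lower_series N = {0}"
    using nil unfolding novikov.nilpotent_def by blast
  have inZ: "lower_series n \<subseteq> Z" if "N \<le> n" for n
  proof -
    have "novikov.lower_series n \<subseteq> novikov.lower_series N"
      using lift_Suc_antimono_le[of novikov.lower_series, OF novikov.lower_series_Suc_subset that] .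
    with incl[of n] N show ?thesis by fastforce
  qed
  obtain m where m: "2 * N = Suc (Suc m)"
    using N by (metis Suc_le_D mult_2 add_Suc_right add_Suc One_nat_def)
  have "circ x y = 0 \<and> br x y = 0"
    if "x \<in> lower_series i" "y \<in> lower_series (2 * N - i)" for i x y
  proof (cases "N \<le> i")
    case True
    then show ?thesis using inZ that(1) ann by blast
  next
    case False
    then have "N \<le> 2 * N - i" by simp
    then show ?thesis using inZ that(2) ann by blast
  qed
  then have "lower_series (2 * N) \<subseteq> novikov.span {0}"
    unfolding m lower_series.simps by (intro novikov.span_mono) (auto simp: m)
  moreover have "0 \<in> lower_series (2 * N)"
    unfolding m lower_series.simps by (rule novikov.span_zero)
  ultimately have "lower_series (2 * N) = {0}" by auto
  then show ?thesis unfolding nilpotent_def using N by (intro exI[of _ "2 * N"]) auto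
qed

text \<open>The compatibility identity for $(x, z, y)$ reads
  $[x, z \circ y] - [y, z \circ x] - z \circ z = 0$, and the brackets are multiples of $z$.
  For $(z, v, r)$ it reduces to $[r, v \circ z] = 0$, so $v \circ z$ is central.
  For $(v, v, w)$ with $[v,w] = kz$ and $k \neq 0$ it shows that $k\, z \circ v$ is a multiple
  of $z$. Each product is thus an eigenvector relation for $z$ and has to vanish.\<close>

lemma heisenberg_center_annihilates:
  assumes nil: novikov.nilpotent
    and z: "br x y = z" "z \<noteq> 0" and central: "\<And>v. br v z = 0"
    and br_span: "\<And>u v. \<exists>c. br u v = scale c z"
    and center: "\<And>u. (\<And>v. br v u = 0) \<Longrightarrow> \<exists>c. u = scale c z"
  shows "circ v z = 0" and "circ z v = 0"
proof -
  have zv: "br z v = 0" for v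
    using central[of v] lie.br_skew[of z v] by simp
  \<comment> \<open>It suffices to see that a product with \<open>z\<close> is a multiple of \<open>z\<close>.\<close>
  have left0: "circ v z = 0" if "circ v z = scale c z" for v c
    using novikov.nilpotent_circ_eigenvalue_zero[OF nil \<open>z \<noteq> 0\<close>, of v c] that by simp
  have right0: "circ z v = 0" if "circ z v = scale c z" for v c
    using novikov.nilpotent_circ_eigenvalue_zero[OF nil \<open>z \<noteq> 0\<close>, of v c] that by simp
  have zz: "circ z z = 0"
  proof -
    obtain c where c: "br x (circ z y) = scale c z" using br_span by blast
    obtain d where d: "br y (circ z x) = scale d z" using br_span by blast
    have "circ z z = scale (c - d) z"
      using compatible[of x z y] by (simp add: c d zv z novikov.mult_simps novikov.scale_left_diff_distrib)
    then show ?thesis by (rule left0)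
  qed
  have vz: "circ v z = 0" for v
  proof -
    have "br r (circ v z) = 0" for r
    proof -
      obtain c where "br v r = scale c z" using br_span by blast
      then show ?thesis
        using compatible[of z v r] by (simp add: zv central zz novikov.mult_simps)
    qed
    then show ?thesis using center left0 by blast
  qed
  then show "circ v z = 0" .
  show "circ z v = 0"
  proof (cases "\<forall>w. br w v = 0")
    case True
    then obtain c where "v = scale c z" using center by blast
    then show ?thesis by (simp add: novikov.mult_simps zz)
  next
    case False
    then obtain w where w: "br v w \<noteq> 0" using lie.br_skew by (metis neg_equal_0_iff_equal)
    obtain k where k: "br v w = scale k z" using br_span by blast
    with w have k0: "k \<noteq> 0" by auto
    obtain c where c: "br v (circ v w) = scale c z" using br_span by blast
    obtain d where d: "br w (circ v v) = scale d z" using br_span by blast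
    have "scale k (circ z v) = scale (c - d) z"
      using compatible[of v v w]
      by (simp add: c d k vz lie.alternating novikov.mult_simps novikov.scale_left_diff_distrib)
    then have "scale (inverse k) (scale k (circ z v)) = scale (inverse k * (c - d)) z"
      by simp
    then have "circ z v = scale (inverse k * (c - d)) z" using k0 by simp
    then show ?thesis by (rule right0)
  qed
qed

end

theorem proposition3p6:
  fixes scale :: "'k::{alg_closed_field, field_char_0} \<Rightarrow> 'a::ab_group_add \<Rightarrow> 'a"
    and circ br :: "'a \<Rightarrow> 'a \<Rightarrow> 'a"
    and B :: "'a set"
  assumes "gd_algebra scale circ br"
    and "finite_dimensional_vector_space scale B"
    and "vector_space.dim scale (UNIV :: 'a set) \<le> 3"
    and "lie_algebra.nilpotent scale br"
    and "novikov_algebra.nilpotent scale circ"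
  shows "gd_algebra.nilpotent scale circ br"
proof -
  interpret gd_algebra scale circ br by (rule assms(1))
  show ?thesis
  proof (cases "\<forall>x y. br x y = 0")
    case True
    show ?thesis
      by (rule nilpotent_if_commutators_annihilate[OF assms(5), of "{0}"])
        (auto simp: True novikov.mult_zero_left novikov.mult_zero_right
          intro: novikov.subspace_single_0)
  next
    case False
    then obtain x y where xy: "br x y \<noteq> 0" by blast
    define z where "z = br x y"
    have z0: "z \<noteq> 0" using xy by (simp add: z_def)
    have central: "br v z = 0" for v
      unfolding z_def by (rule lie.nilpotent_commutator_central[OF assms(2-4)])
    have zv: "br z v = 0" for v
      using central[of v] lie.br_skew[of z v] by simp
    note bracket = lie.nilpotent_bracket_and_center[OF assms(2-4) xy, folded z_def]
    note ann = heisenberg_center_annihilates[OF assms(5) z_def[symmetric] z0 central bracket]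
    show ?thesis
    proof (rule nilpotent_if_commutators_annihilate[OF assms(5), of "novikov.span {z}"])
      fix u v
      show "br u v \<in> novikov.span {z}"
        using bracket(1)[of u v] by (auto intro!: novikov.span_scale intro: novikov.span_base)
    next
      fix w v
      assume "w \<in> novikov.span {z}"
      then obtain c where "w = scale c z" by (auto simp: novikov.span_breakdown_eq)
      then show "circ w v = 0 \<and> circ v w = 0 \<and> br w v = 0 \<and> br v w = 0"
        by (simp add: novikov.mult_simps lie.mult_simps ann central zv)
    qed (rule novikov.subspace_span)
  qed
qed

end
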